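(* Let $c=c(\mathbf{b})$ be a positive integer and let $\mathcal{F}^0_{\mathbf{b}}$ be the degree two fiber of binary $c$-way tables defined by $$\mathcal{F}^0_{\mathbf{b}}=\{(0\,i_2\cdots i_c)(1\,i_2^*\cdots i_c^* )\mid (i_2,\dots,i_c)\in\{0,1\}^{c-1}\}.$$ For $\mathbf{v}=(v_2,\dots,v_c)\in\mathcal{V}^{c-1}$ put $$\mathbf{n}^{\mathbf{b}}_0=(00\cdots0)(11\cdots1),\qquad \mathbf{n}^{\mathbf{b}}_{\mathbf{v}}=(0\,v_2\cdots v_c)(1\,v_2^*\cdots v_c^* ),\qquad \mathbf{z}^{\mathbf{b}}_{\mathbf{v}}=\mathbf{n}^{\mathbf{b}}_0-\mathbf{n}^{\mathbf{b}}_{\mathbf{v}}.$$ Let $\mathcal{M}_{G_{\mathbf{b}}}$ be an $S_2^{c-1}$-invariant set of moves in $\mathcal{F}^0_{\mathbf{b}}$. Then $\mathcal{M}_{G_{\mathbf{b}}}$ is a minimal $S_2^{c-1}$-invariant set of moves that connects $\mathcal{F}^0_{\mathbf{b}}$ if and only if there is a basis $\mathcal{V}^0=\{\mathbf{v}_2,\dots,\mathbf{v}_c\}$ of the vector space $\mathcal{V}^{c-1}$ such that $\mathbf{z}^{\mathbf{b}}_{\mathbf{v}_k}$, $k=2,\dots,c$, are representative moves of the $S_2^{c-1}$-orbits in $\mathcal{M}_{G_{\mathbf{b}}}$ (i.e. $\mathcal{M}_{G_{\mathbf{b}}}$ is the union of the distinct orbits $S_2^{c-1}(\mathbf{z}^{\mathbf{b}}_{\mathbf{v}_k})$,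 $k=2,\dots,c$). Hence the number $\kappa(\mathbf{b})$ of $S_2^{c-1}$-orbits in a minimal $S_2^{c-1}$-invariant set of moves connecting $\mathcal{F}^0_{\mathbf{b}}$ is $c-1$.
   Context: Cells are elements of $\{0,1\}^c$. For distinct cells $i,j$, $(i)(j)$ denotes the table with frequency $1$ at $i$ and at $j$ and $0$ elsewhere (so $(i)(j)=(j)(i)$). For $a\in\{0,1\}$, $a^*=1-a$. The set $\mathcal{F}^0_{\mathbf{b}}$ is the fiber, for the complete independence model $\mathcal{D}=\{\{1\},\dots,\{c\}\}$, of all tables whose one-dimensional marginals are all equal to $(1,1)$. $\mathcal{V}^{c-1}=\{0,1\}^{c-1}$ is the $(c-1)$-dimensional vector space over the field $\mathrm{GF}(2)$, with coordinates indexed by $2,\dots,c$. The group $S_2^{c-1}$, with elements $g=(g_2,\dots,g_c)$, each $g_l\in S_2$ a permutation of $\{0,1\}$, acts on $\mathcal{F}^0_{\mathbf{b}}$ by $g\big((0\,i_2\cdots i_c)(1\,i_2^*\cdots i_c^* )\big)=(0\,g_2(i_2)\cdots g_c(i_c))(1\,g_2(i_2^* )\cdots g_c(i_c^* ))$, and on moves by $g(\mathbf{n}-\mathbf{n}')=g(\mathbf{n})-g(\mathbf{n}')$. A move in $\mathcal{F}^0_{\mathbf{b}}$ is a difference $\mathbf{n}-\mathbf{n}'$ of distinct $\mathbf{n},\mathbf{n}'\in\mathcal{F}^0_{\mathbf{b}}$; moves are considered up to sign ($\mathbf{z}$ is identified with $-\mathbf{z}$). A set $\mathcal{M}$ of moves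 is invariant under a group $G$ if for $g\in G$, $\mathbf{z}\in\mathcal{M}$ one has $g(\mathbf{z})\in\mathcal{M}$ or $-g(\mathbf{z})\in\mathcal{M}$. $\mathcal{M}$ connects $\mathcal{F}^0_{\mathbf{b}}$ if any two elements of $\mathcal{F}^0_{\mathbf{b}}$ are joined by a finite sequence of elements of $\mathcal{F}^0_{\mathbf{b}}$ with consecutive differences $\pm\mathbf{z}$, $\mathbf{z}\in\mathcal{M}$. A $G$-invariant set of moves connecting $\mathcal{F}^0_{\mathbf{b}}$ is minimal if no proper $G$-invariant subset of it connects $\mathcal{F}^0_{\mathbf{b}}$. *)

theory Defs
  imports Complex_Main "HOL-Library.FuncSet" "HOL-Library.Function_Algebras" "HOL-Library.Z2"
begin

text \<open>
  The type \<open>bit\<close> of \<^theory>\<open>HOL-Library.Z2\<close> is the field GF(2). The space with coordinates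
  \<open>2, \<dots>, c\<close> is the subspace of all functions \<open>nat \<Rightarrow> bit\<close> that vanish outside \<open>{2..c}\<close>.
\<close>

definition bscale :: "bit \<Rightarrow> (nat \<Rightarrow> bit) \<Rightarrow> nat \<Rightarrow> bit" where
  "bscale a v = (\<lambda>l. a * v l)"

interpretation gf2: vector_space bscale
proof
  fix a b :: bit and x y :: "nat \<Rightarrow> bit"
  show "bscale a (x + y) = bscale a x + bscale a y"
    unfolding bscale_def by (rule ext) (simp only: plus_fun_apply distrib_left)
  show "bscale (a + b) x = bscale a x + bscale b x"
    unfolding bscale_def by (rule ext) (simp only: plus_fun_apply distrib_right)
  show "bscale a (bscale b x) = bscale (a * b) x"
    unfolding bscale_def by (simp only: mult.assoc)
  show "bscale 1 x = x"
    unfolding bscale_def by (simp only: mult_1_left)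
qed

definition V :: "nat \<Rightarrow> (nat \<Rightarrow> bit) set" where
  "V c = {v. \<forall>l. l \<notin> {2..c} \<longrightarrow> v l = 0}"

lemma subspace_V: "gf2.subspace (V c)"
  unfolding gf2.subspace_def V_def bscale_def mem_Collect_eq
  by (simp only: plus_fun_apply zero_fun_apply mult_zero_right add_0_left) simp

definition is_basis :: "nat \<Rightarrow> (nat \<Rightarrow> bit) set \<Rightarrow> bool" where
  "is_basis c B \<longleftrightarrow> B \<subseteq> V c \<and> gf2.independent B \<and> gf2.span B = V c"

type_synonym cell = "nat \<Rightarrow> bit"
type_synonym tab = "cell \<Rightarrow> int"

text \<open>
  A cell has coordinates \<open>1, \<dots>, c\<close>; the coordinates outside \<open>{1..c}\<close> are fixed to \<open>0\<close>.
  Tables and differences of tables are integer-valued and vanish outside \<open>cells c\<close>.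
\<close>

definition cells :: "nat \<Rightarrow> cell set" where
  "cells c = {x. \<forall>l. l \<notin> {1..c} \<longrightarrow> x l = 0}"

text \<open>\<open>mk_cell c a v\<close> is the cell \<open>(a v\<^sub>2 \<dots> v\<^sub>c)\<close>.\<close>

definition mk_cell :: "nat \<Rightarrow> bit \<Rightarrow> (nat \<Rightarrow> bit) \<Rightarrow> cell" where
  "mk_cell c a v = (\<lambda>l. if l = 1 then a else if l \<in> {2..c} then v l else 0)"

definition star :: "(nat \<Rightarrow> bit) \<Rightarrow> nat \<Rightarrow> bit" where
  "star v = (\<lambda>l. 1 - v l)"

text \<open>The table \<open>(i)(j)\<close>; only used for \<open>i \<noteq> j\<close>.\<close>

definition two_cells :: "cell \<Rightarrow> cell \<Rightarrow> tab" where
  "two_cells i j = (\<lambda>x. of_bool (x = i \<or> x = j))"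

definition nb :: "nat \<Rightarrow> (nat \<Rightarrow> bit) \<Rightarrow> tab" where
  "nb c v = two_cells (mk_cell c 0 v) (mk_cell c 1 (star v))"

definition F0 :: "nat \<Rightarrow> tab set" where
  "F0 c = {nb c v | v. v \<in> V c}"

definition zb :: "nat \<Rightarrow> (nat \<Rightarrow> bit) \<Rightarrow> tab" where
  "zb c v = nb c 0 - nb c v"

text \<open>A move \<open>z\<close> is identified with \<open>- z\<close>: it is represented by the class \<open>{z, - z}\<close>.\<close>

definition pm :: "tab \<Rightarrow> tab set" where
  "pm z = {z, - z}"

lemma pm_eq_iff: "pm z = pm z' \<longleftrightarrow> z' = z \<or> z' = - z"
proof -
  have "- (- w) = w" for w :: tab by (simp add: fun_eq_iff)
  then show ?thesis unfolding pm_def by (metis doubleton_eq_iff)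
qed

definition moves :: "nat \<Rightarrow> tab set set" where
  "moves c = {pm (n - n') | n n'. n \<in> F0 c \<and> n' \<in> F0 c \<and> n \<noteq> n'}"

definition S2_power :: "nat \<Rightarrow> (nat \<Rightarrow> bit \<Rightarrow> bit) set" where
  "S2_power c = (\<Pi>\<^sub>E l\<in>{2..c}. {p. bij p})"

definition act_cell :: "nat \<Rightarrow> (nat \<Rightarrow> bit \<Rightarrow> bit) \<Rightarrow> cell \<Rightarrow> cell" where
  "act_cell c g x = (\<lambda>l. if l \<in> {2..c} then g l (x l) else x l)"

text \<open>
  The group permutes the cells and thereby acts on tables and, linearly, on differences of
  tables: the frequency of \<open>n\<close> at \<open>x\<close> is the frequency of \<open>g n\<close> at \<open>g x\<close>.
\<close>

definition act :: "nat \<Rightarrow> (nat \<Rightarrow> bit \<Rightarrow> bit) \<Rightarrow> tab \<Rightarrow> tab" where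
  "act c g n = (\<lambda>x. n (inv (act_cell c g) x))"

definition orbit :: "nat \<Rightarrow> tab \<Rightarrow> tab set set" where
  "orbit c z = {pm (act c g z) | g. g \<in> S2_power c}"

definition orbits :: "nat \<Rightarrow> tab set set \<Rightarrow> tab set set set" where
  "orbits c M = {orbit c z | z. pm z \<in> M}"

definition invariant :: "nat \<Rightarrow> tab set set \<Rightarrow> bool" where
  "invariant c M \<longleftrightarrow> (\<forall>g\<in>S2_power c. \<forall>z. pm z \<in> M \<longrightarrow> pm (act c g z) \<in> M)"

definition connects :: "nat \<Rightarrow> tab set set \<Rightarrow> bool" where
  "connects c M \<longleftrightarrow> (\<forall>n\<in>F0 c. \<forall>n'\<in>F0 c.
     (n, n') \<in> {(m, m'). m \<in> F0 c \<and> m' \<in> F0 c \<and> pm (m' - m) \<in> M}\<^sup>*)"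

definition minimal_connecting :: "nat \<Rightarrow> tab set set \<Rightarrow> bool" where
  "minimal_connecting c M \<longleftrightarrow> M \<subseteq> moves c \<and> invariant c M \<and> connects c M \<and>
     (\<forall>M'. M' \<subset> M \<and> invariant c M' \<longrightarrow> \<not> connects c M')"

lemma bij_act_cell:
  assumes "g \<in> S2_power c"
  shows "bij (act_cell c g)"
proof (rule o_bij)
  let ?h = "\<lambda>x l. if l \<in> {2..c} then inv (g l) (x l) else x l"
  have b: "bij (g l)" if "l \<in> {2..c}" for l
    using assms that by (auto simp: S2_power_def PiE_iff)
  show "?h \<circ> act_cell c g = id" "act_cell c g \<circ> ?h = id"
    using b by (auto simp: act_cell_def fun_eq_iff bij_is_inj bij_is_surj surj_f_inv_f)
qed

lemma act_two_cells:
  assumes "g \<in> S2_power c"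
  shows "act c g (two_cells i j) = two_cells (act_cell c g i) (act_cell c g j)"
proof -
  have "inv (act_cell c g) x = y \<longleftrightarrow> x = act_cell c g y" for x y
    using bij_act_cell[OF assms] by (metis bij_inv_eq_iff)
  then show ?thesis by (simp add: act_def two_cells_def)
qed

lemma act_nb:
  assumes "g \<in> S2_power c"
  shows "act c g (nb c v) =
    two_cells (mk_cell c 0 (\<lambda>l. g l (v l))) (mk_cell c 1 (\<lambda>l. g l (star v l)))"
proof -
  have "act_cell c g (mk_cell c a w) = mk_cell c a (\<lambda>l. g l (w l))" for a w
    by (auto simp: act_cell_def mk_cell_def)
  then show ?thesis by (simp add: nb_def act_two_cells[OF assms])
qed

lemma act_diff: "act c g (n - n') = act c g n - act c g n'"
  by (simp add: act_def fun_eq_iff)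

text \<open>
  \<open>F0 c\<close> is the fiber of the complete independence model consisting of all nonnegative
  tables with all one-dimensional marginals equal to \<open>(1, 1)\<close>.
\<close>

definition marginal :: "nat \<Rightarrow> tab \<Rightarrow> nat \<Rightarrow> bit \<Rightarrow> int" where
  "marginal c n l a = (\<Sum>x | x \<in> cells c \<and> x l = a. n x)"

lemma finite_cells: "finite (cells c)"
proof -
  have "(UNIV :: bit set) = {0, 1}" by (auto simp: bit_not_zero_iff)
  then have fin: "finite (UNIV :: bit set)" by (metis finite.emptyI finite_insert)
  have "cells c = {x. \<forall>l. (l \<in> {1..c} \<longrightarrow> x l \<in> UNIV) \<and> (l \<notin> {1..c} \<longrightarrow> x l = 0)}"
    unfolding cells_def by blast
  also have "finite \<dots>" by (rule finite_set_of_finite_funs[OF finite_atLeastAtMost fin])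
  finally show ?thesis .
qed

lemma marginal_two_cells:
  assumes "i \<in> cells c" "j \<in> cells c" "j l \<noteq> i l"
  shows "marginal c (two_cells i j) l a = 1"
proof -
  obtain u where u: "u = i \<or> u = j" "u l = a"
    using assms(3) by (metis bit_not_one_iff)
  have "marginal c (two_cells i j) l a =
      (\<Sum>x | x \<in> cells c \<and> x l = a. if x = u then 1 else 0)"
    unfolding marginal_def two_cells_def using u assms by (intro sum.cong) auto
  also have "\<dots> = 1" using u assms finite_cells[of c] by auto
  finally show ?thesis .
qed

lemma F0_eq_fiber:
  assumes "1 \<le> c"
  shows "F0 c = {n. (\<forall>x. 0 \<le> n x) \<and> (\<forall>x. x \<notin> cells c \<longrightarrow> n x = 0) \<and>
                    (\<forall>l\<in>{1..c}. \<forall>a. marginal c n l a = 1)}" (is "_ = ?F")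
proof (rule set_eqI, rule iffI)
  fix n assume "n \<in> F0 c"
  then obtain v where n: "n = two_cells (mk_cell c 0 v) (mk_cell c 1 (star v))"
    by (auto simp: F0_def nb_def)
  let ?x = "mk_cell c 0 v" and ?y = "mk_cell c 1 (star v)"
  have cx: "?x \<in> cells c" "?y \<in> cells c" using assms by (auto simp: cells_def mk_cell_def)
  have "marginal c n l a = 1" if l: "l \<in> {1..c}" for l a
  proof -
    have "?y l = 1 - ?x l" using l by (auto simp: mk_cell_def star_def)
    then have yx: "?y l \<noteq> ?x l" by (cases "?x l") auto
    then show ?thesis unfolding n by (rule marginal_two_cells[OF cx])
  qed
  moreover have "0 \<le> n x" for x by (simp add: n two_cells_def)
  moreover have "n x = 0" if "x \<notin> cells c" for x
    using that cx unfolding n two_cells_def by (metis of_bool_eq(1))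
  ultimately show "n \<in> ?F" by blast
next
  fix n assume "n \<in> ?F"
  then have pos: "\<And>x. 0 \<le> n x" and out: "\<And>x. x \<notin> cells c \<Longrightarrow> n x = 0"
    and mar: "\<And>l a. l \<in> {1..c} \<Longrightarrow> marginal c n l a = 1" by auto
  have fin: "finite {x \<in> cells c. x l = a}" for l a using finite_cells by simp
  have single: "\<exists>u. u \<in> cells c \<and> u l = a \<and> n u = 1" if "l \<in> {1..c}" for l a
  proof -
    have "\<exists>u\<in>{x \<in> cells c. x l = a}. n u \<noteq> 0"
    proof (rule ccontr)
      assume "\<not> ?thesis"
      then have "marginal c n l a = 0" unfolding marginal_def by (intro sum.neutral) blast
      then show False using mar[OF that, of a] by simp
    qed
    then obtain u where u: "u \<in> {x \<in> cells c. x l = a}" "n u \<noteq> 0" by blast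
    have "n u \<le> marginal c n l a"
      unfolding marginal_def using u fin pos by (intro member_le_sum) auto
    then have "n u = 1" using u(2) mar[OF that, of a] pos[of u] by linarith
    then show ?thesis using u(1) by blast
  qed
  have uniq: "u = w" if "l \<in> {1..c}" "u \<in> cells c" "w \<in> cells c" "u l = w l" "n u \<noteq> 0" "n w \<noteq> 0"
    for l u w
  proof (rule ccontr)
    assume "u \<noteq> w"
    have "sum n {u, w} \<le> marginal c n l (u l)"
      unfolding marginal_def using that fin pos by (intro sum_mono2) auto
    moreover have "sum n {u, w} = n u + n w" using \<open>u \<noteq> w\<close> by simp
    ultimately show False
      using that(5,6) mar[OF that(1), of "u l"] pos[of u] pos[of w] by linarith
  qed
  have one: "1 \<in> {1..c}" using assms by simp
  obtain u where u: "u \<in> cells c" "u 1 = 0" "n u = 1" using single[OF one, of 0] by blast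
  obtain w where w: "w \<in> cells c" "w 1 = 1" "n w = 1" using single[OF one, of 1] by blast
  define v where "v = (\<lambda>l. if l \<in> {2..c} then u l else 0)"
  have uv: "u = mk_cell c 0 v"
  proof
    fix l
    have "l = 1 \<or> l \<in> {2..c} \<or> l \<notin> {1..c} \<and> l \<noteq> 1" by auto
    then show "u l = mk_cell c 0 v l"
      using u(1,2) unfolding mk_cell_def v_def cells_def by fastforce
  qed
  have "w l = 1 - u l" if "l \<in> {1..c}" for l
  proof -
    have "u \<noteq> w" using u(2) w(2) by (metis zero_neq_one)
    then have "u l \<noteq> w l" using uniq[OF that u(1) w(1)] u(3) w(3) by (metis zero_neq_one)
    then show ?thesis by (cases "u l"; cases "w l") auto
  qed
  then have wu: "w l = 1 - u l" if "l \<in> {2..c}" for l using that by simp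
  have wv: "w = mk_cell c 1 (star v)"
  proof
    fix l
    have "l = 1 \<or> l \<in> {2..c} \<or> l \<notin> {1..c} \<and> l \<noteq> 1" by auto
    then show "w l = mk_cell c 1 (star v) l"
      using w(1,2) wu[of l] unfolding mk_cell_def v_def star_def cells_def by fastforce
  qed
  have "n x = two_cells u w x" for x
  proof (cases "x = u \<or> x = w")
    case False
    have "n x = 0"
    proof (rule ccontr)
      assume nx: "n x \<noteq> 0"
      then have cx: "x \<in> cells c" using out by blast
      have "x 1 = u 1 \<or> x 1 = w 1" unfolding u(2) w(2) by (cases "x 1") auto
      then show False
        using uniq[OF one cx u(1) _ nx] uniq[OF one cx w(1) _ nx] u(3) w(3) False
        by (metis zero_neq_one)
    qed
    then show ?thesis using False by (simp add: two_cells_def)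
  qed (use u(3) w(3) in \<open>auto simp: two_cells_def\<close>)
  then have "n = nb c v" by (simp add: nb_def uv wv fun_eq_iff)
  then show "n \<in> F0 c" by (auto simp: F0_def V_def v_def)
qed

end

theory Submission
  imports Defs
begin

text \<open>
  Since \<open>S\<^sub>2\<close> acts on \<open>{0, 1}\<close> by the translations of GF(2), the group \<open>S\<^sub>2\<^sup>c\<^sup>-\<^sup>1\<close> acts on the fiber
  \<open>{n\<^sub>v | v \<in> V}\<close> as the translation group of \<open>V\<close>. The orbit of a move \<open>n\<^sub>a - n\<^sub>b\<close> up to sign is
  therefore determined by the direction \<open>a + b\<close>, so that invariant sets of moves correspond to sets
  \<open>D\<close> of nonzero vectors, inclusion being preserved. The graph on the fiber defined by \<open>D\<close> is the
  Cayley graph of \<open>V\<close> with respect to \<open>D\<close>, which is connected iff \<open>D\<close> spans \<open>V\<close>; hence the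
  minimal connecting invariant sets correspond to the minimal spanning sets, i.e. the bases.
\<close>

section \<open>The space \<open>V c\<close>\<close>

lemma bit_fun_add_self [simp]: "(v :: 'a \<Rightarrow> bit) + v = 0"
  by (simp add: fun_eq_iff)

lemma bit_fun_add_self_left [simp]: "(v :: 'a \<Rightarrow> bit) + (v + w) = w"
  by (simp add: add.assoc[symmetric])

lemma bit_fun_add_eq_iff: "(u :: 'a \<Rightarrow> bit) + v = w \<longleftrightarrow> v = u + w"
  by (metis bit_fun_add_self_left)

lemma V_add: "v \<in> V c \<Longrightarrow> w \<in> V c \<Longrightarrow> v + w \<in> V c"
  by (rule gf2.subspace_add[OF subspace_V])

lemma V_zero: "0 \<in> V c"
  by (rule gf2.subspace_0[OF subspace_V])

definition unit_vec :: "nat \<Rightarrow> nat \<Rightarrow> bit" where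
  "unit_vec k = (\<lambda>l. of_bool (l = k))"

lemma inj_unit_vec: "inj unit_vec"
proof (rule injI)
  fix k k' assume "unit_vec k = unit_vec k'"
  then have "unit_vec k k = unit_vec k' k" by simp
  then show "k = k'" by (simp add: unit_vec_def split: if_splits)
qed

text \<open>One explicit basis serves twice: it yields a minimal connecting set, and its indexing by
  \<open>{2..c}\<close> fixes the size of every basis.\<close>

lemma is_basis_unit_vec: "is_basis c (unit_vec ` {2..c})"
proof -
  let ?E = "unit_vec ` {2..c}"
  have sub: "?E \<subseteq> V c" by (auto simp: V_def unit_vec_def)
  have "gf2.independent ?E"
    unfolding gf2.dependent_def
  proof safe
    fix k assume k: "k \<in> {2..c}" and "unit_vec k \<in> gf2.span (?E - {unit_vec k})"
    \<comment> \<open>This hyperplane contains all the other unit vectors, hence their span, but not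
      \<open>unit_vec k\<close>.\<close>
    moreover have "gf2.subspace {v. v k = 0}"
      by (auto simp: gf2.subspace_def bscale_def)
    moreover have "?E - {unit_vec k} \<subseteq> {v. v k = 0}"
      by (auto simp: unit_vec_def)
    ultimately have "unit_vec k k = 0"
      using gf2.span_minimal by blast
    then show False by (simp add: unit_vec_def)
  qed
  moreover have "gf2.span ?E = V c"
  proof
    show "gf2.span ?E \<subseteq> V c" by (rule gf2.span_minimal[OF sub subspace_V])
    show "V c \<subseteq> gf2.span ?E"
    proof
      fix v assume v: "v \<in> V c"
      \<comment> \<open>Stated for every finite \<open>A\<close> so that induction applies; at
        \<open>A = {2..c}\<close> the sum is \<open>v\<close>, which vanishes at all other
        coordinates.\<close>
      have "(\<Sum>k\<in>A. bscale (v k) (unit_vec k)) l = of_bool (l \<in> A) * v l" if "finite A" for A l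
        using that
        by (induction A) (auto simp: bscale_def unit_vec_def)
      then have "v = (\<Sum>k\<in>{2..c}. bscale (v k) (unit_vec k))"
        using v by (auto simp: V_def fun_eq_iff)
      moreover have "\<dots> \<in> gf2.span ?E"
        by (intro gf2.span_sum gf2.span_scale gf2.span_base) auto
      ultimately show "v \<in> gf2.span ?E" by simp
    qed
  qed
  ultimately show ?thesis using sub by (simp add: is_basis_def)
qed

text \<open>Any two bases of one space are equinumerous, so a basis can be compared with the unit
  vectors.\<close>

lemma is_basis_bij_betw:
  assumes "is_basis c B"
  shows "\<exists>v. bij_betw v {2..c} B"
proof -
  have "\<exists>f. bij_betw f (unit_vec ` {2..c}) B"
    using assms is_basis_unit_vec[of c] unfolding is_basis_def
    by (intro gf2.bij_if_span_eq_span_bases) auto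
  moreover have "bij_betw unit_vec {2..c} (unit_vec ` {2..c})"
    using inj_unit_vec by (auto simp: bij_betw_def inj_on_def)
  ultimately show ?thesis using bij_betw_trans by blast
qed

lemma is_basis_nonzero: "is_basis c B \<Longrightarrow> 0 \<notin> B"
  using gf2.dependent_zero by (auto simp: is_basis_def)

lemma is_basis_iff_minimal_spanning:
  assumes "D \<subseteq> V c"
  shows "is_basis c D \<longleftrightarrow> gf2.span D = V c \<and> (\<forall>D'. D' \<subset> D \<longrightarrow> gf2.span D' \<noteq> V c)"
proof (intro iffI conjI allI impI)
  assume B: "is_basis c D"
  then show "gf2.span D = V c" by (simp add: is_basis_def)
  fix D' assume D': "D' \<subset> D"
  \<comment> \<open>The span is monotone, so it is enough to see what is lost by omitting one
    vector.\<close>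
  then obtain d where d: "d \<in> D" "D' \<subseteq> D - {d}" by blast
  then have "d \<notin> gf2.span D'"
    using B gf2.span_mono[OF d(2)] by (auto simp: is_basis_def gf2.dependent_def)
  then show "gf2.span D' \<noteq> V c" using d(1) assms by auto
next
  assume R: "gf2.span D = V c \<and> (\<forall>D'. D' \<subset> D \<longrightarrow> gf2.span D' \<noteq> V c)"
  \<comment> \<open>A vector in the span of the others could be dropped, against minimality.\<close>
  have "gf2.span (D - {d}) = gf2.span D" if "d \<in> D" "d \<in> gf2.span (D - {d})" for d
    using gf2.span_redundant[OF that(2)] that(1) by (simp add: insert_absorb)
  then have "gf2.independent D" using R by (auto simp: gf2.dependent_def)
  then show "is_basis c D" using R assms by (simp add: is_basis_def)
qed

section \<open>The fiber and the group action\<close>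

lemma mk_cell_eq_iff:
  assumes "v \<in> V c" "w \<in> V c"
  shows "mk_cell c a v = mk_cell c b w \<longleftrightarrow> a = b \<and> v = w"
proof
  assume eq: "mk_cell c a v = mk_cell c b w"
  have "v l = w l" for l
    using fun_cong[OF eq, of l] assms by (cases "l \<in> {2..c}") (auto simp: mk_cell_def V_def)
  moreover have "a = b" using fun_cong[OF eq, of 1] by (simp add: mk_cell_def)
  ultimately show "a = b \<and> v = w" by auto
qed simp

text \<open>Only one of the two cells of the table has first coordinate 0, so values at such cells
  turn \<open>nb c v\<close> into the indicator of \<open>v\<close> on \<open>V c\<close>.\<close>

lemma nb_at_mk_cell:
  assumes "v \<in> V c" "w \<in> V c"
  shows "nb c v (mk_cell c 0 w) = of_bool (v = w)"
proof -
  have "mk_cell c 0 w 1 \<noteq> mk_cell c 1 (star v) 1" by (simp add: mk_cell_def)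
  then have "mk_cell c 0 w \<noteq> mk_cell c 1 (star v)" by metis
  then show ?thesis
    using assms by (auto simp: nb_def two_cells_def mk_cell_eq_iff)
qed

lemma nb_eq_iff: "v \<in> V c \<Longrightarrow> w \<in> V c \<Longrightarrow> nb c v = nb c w \<longleftrightarrow> v = w"
  by (metis nb_at_mk_cell of_bool_eq(1,2) zero_neq_one)

text \<open>Both sides are differences of two indicators. A nonzero difference determines both ends;
  a zero one only makes the ends equal, and then the sum is 0 anyway.\<close>

lemma nb_diff_eq_imp:
  assumes V: "a \<in> V c" "b \<in> V c" "a' \<in> V c" "b' \<in> V c"
    and eq: "nb c a - nb c b = nb c a' - nb c b'"
  shows "a + b = a' + b'"
proof -
  have d: "of_bool (a = d) - of_bool (b = d) = (of_bool (a' = d) - of_bool (b' = d) :: int)"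
    if "d \<in> V c" for d
    using fun_cong[OF eq, of "mk_cell c 0 d"] V that by (simp add: nb_at_mk_cell)
  show ?thesis
    using d[OF V(1)] d[OF V(2)] d[OF V(3)]
    by (cases "a = b"; cases "a' = b'") (auto split: if_splits simp: of_bool_def)
qed

lemma pm_commute: "pm (x - y) = pm (y - x)"
  by (auto simp: pm_def)

lemma pm_nb_diff_eq_imp:
  assumes V: "a \<in> V c" "b \<in> V c" "a' \<in> V c" "b' \<in> V c"
    and eq: "pm (nb c a - nb c b) = pm (nb c a' - nb c b')"
  shows "a + b = a' + b'"
proof -
  have "nb c a' - nb c b' = nb c a - nb c b \<or> nb c a' - nb c b' = nb c b - nb c a"
    using eq by (simp add: pm_eq_iff)
  then show ?thesis
    using nb_diff_eq_imp V by (metis add.commute)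
qed

section \<open>The group as the translations of \<open>V c\<close>\<close>

lemma bij_bit_eq_add:
  fixes p :: "bit \<Rightarrow> bit"
  assumes "bij p"
  shows "p x = p 0 + x"
proof -
  have "p 0 \<noteq> p 1" using bij_is_inj[OF assms] by (simp add: inj_eq)
  then show ?thesis by (cases x; cases "p 0"; cases "p 1") simp_all
qed

text \<open>Complementation is itself a translation, by the all-ones vector. It therefore commutes
  with the translation by \<open>u\<close>, and the second cell stays complementary to the
  first.\<close>

lemma act_nb_translation:
  assumes "g \<in> S2_power c" and g: "\<And>l x. l \<in> {2..c} \<Longrightarrow> g l x = u l + x"
  shows "act c g (nb c v) = nb c (u + v)"
proof -
  have "mk_cell c 0 (\<lambda>l. g l (v l)) = mk_cell c 0 (u + v)"
    "mk_cell c 1 (\<lambda>l. g l (star v l)) = mk_cell c 1 (star (u + v))"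
    using g by (auto simp: mk_cell_def star_def fun_eq_iff)
  then show ?thesis unfolding act_nb[OF assms(1)] unfolding nb_def by simp
qed

lemma S2_power_imp_translation:
  assumes g: "g \<in> S2_power c"
  obtains u where "u \<in> V c" "\<And>v. act c g (nb c v) = nb c (u + v)"
proof
  \<comment> \<open>A translation is determined by the image of 0; the default 0 places the vector
    in \<open>V c\<close>.\<close>
  let ?u = "\<lambda>l. if l \<in> {2..c} then g l 0 else 0"
  show "?u \<in> V c" by (simp add: V_def)
  have "g l x = ?u l + x" if "l \<in> {2..c}" for l x
  proof -
    have "bij (g l)" using g that by (auto simp: S2_power_def PiE_iff)
    then have "g l x = g l 0 + x" by (rule bij_bit_eq_add)
    then show ?thesis using that by (simp only: if_True)
  qed
  then show "act c g (nb c v) = nb c (?u + v)" for v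
    by (rule act_nb_translation[OF g])
qed

lemma translation_in_S2_power:
  obtains g where "g \<in> S2_power c" "\<And>v. act c g (nb c v) = nb c (u + v)"
proof
  let ?g = "\<lambda>l\<in>{2..c}. \<lambda>x. u l + x"
  \<comment> \<open>In characteristic 2 a translation is its own inverse.\<close>
  have "bij (\<lambda>x. b + x)" for b :: bit
    by (rule o_bij[where g = "\<lambda>x. b + x"]) (auto simp: fun_eq_iff add.assoc[symmetric])
  then show "?g \<in> S2_power c" by (auto simp: S2_power_def)
  then show "act c ?g (nb c v) = nb c (u + v)" for v
    by (rule act_nb_translation) simp
qed

section \<open>Orbits of moves and their directions\<close>

lemma orbit_nb_diff:
  "orbit c (nb c a - nb c b) = {pm (nb c (u + a) - nb c (u + b)) | u. u \<in> V c}"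
proof (intro set_eqI iffI)
  fix m assume "m \<in> orbit c (nb c a - nb c b)"
  then obtain g where g: "g \<in> S2_power c" "m = pm (act c g (nb c a - nb c b))"
    by (auto simp: orbit_def)
  obtain u where "u \<in> V c" "\<And>v. act c g (nb c v) = nb c (u + v)"
    using S2_power_imp_translation[OF g(1)] by blast
  then show "m \<in> {pm (nb c (u + a) - nb c (u + b)) | u. u \<in> V c}"
    using g(2) by (auto simp: act_diff)
next
  fix m assume "m \<in> {pm (nb c (u + a) - nb c (u + b)) | u. u \<in> V c}"
  then obtain u where u: "m = pm (nb c (u + a) - nb c (u + b))" by blast
  obtain g where "g \<in> S2_power c" "\<And>v. act c g (nb c v) = nb c (u + v)"
    using translation_in_S2_power by blast
  then show "m \<in> orbit c (nb c a - nb c b)"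
    using u by (auto simp: orbit_def act_diff intro!: exI[of _ g])
qed

lemma orbit_zb:
  "orbit c (zb c v) = {pm (nb c u - nb c (u + v)) | u. u \<in> V c}"
  by (simp only: zb_def orbit_nb_diff add_0_right)

text \<open>Translation by \<open>a\<close> carries the ends \<open>a\<close> and \<open>b\<close>
  to 0 and \<open>a + b\<close>. Reindexing the orbit by it is harmless because it permutes
  \<open>V c\<close>.\<close>

lemma orbit_nb_diff_eq_orbit_zb:
  assumes "a \<in> V c"
  shows "orbit c (nb c a - nb c b) = orbit c (zb c (a + b))"
proof -
  let ?f = "\<lambda>u. pm (nb c u - nb c (u + (a + b)))"
  have "(\<lambda>u. u + a) ` V c = V c"
  proof
    show "(\<lambda>u. u + a) ` V c \<subseteq> V c" using assms V_add by blast
    show "V c \<subseteq> (\<lambda>u. u + a) ` V c"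
    proof
      fix u assume "u \<in> V c"
      moreover have "u = (u + a) + a" by (simp add: add.assoc)
      ultimately show "u \<in> (\<lambda>u. u + a) ` V c" using assms V_add by blast
    qed
  qed
  then have "?f ` V c = ?f ` (\<lambda>u. u + a) ` V c" by (rule arg_cong[OF sym])
  also have "\<dots> = (\<lambda>u. pm (nb c (u + a) - nb c (u + b))) ` V c"
    by (simp add: image_image add.assoc)
  finally show ?thesis unfolding orbit_zb orbit_nb_diff Setcompr_eq_image by (rule sym)
qed

text \<open>Needed because a class \<open>pm z\<close> determines its representative only up to
  sign.\<close>

lemma orbit_uminus: "orbit c (- z) = orbit c z"
proof -
  have "act c g (- z) = - act c g z" for g
    by (simp add: act_def fun_eq_iff)
  then have "pm (act c g (- z)) = pm (act c g z)" for g
    by (metis pm_eq_iff)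
  then show ?thesis by (simp add: orbit_def)
qed

text \<open>The sum of the ends survives translation, since \<open>u + u = 0\<close>, and the swap
  caused by a change of sign. It is thus a complete invariant of the orbit.\<close>

lemma pm_nb_diff_in_orbit_iff:
  assumes "a \<in> V c" "b \<in> V c" "v \<in> V c"
  shows "pm (nb c a - nb c b) \<in> orbit c (zb c v) \<longleftrightarrow> a + b = v"
proof
  assume "pm (nb c a - nb c b) \<in> orbit c (zb c v)"
  then obtain u where "u \<in> V c" "pm (nb c a - nb c b) = pm (nb c u - nb c (u + v))"
    by (auto simp: orbit_zb)
  then show "a + b = v"
    using pm_nb_diff_eq_imp[OF assms(1,2), of u "u + v"] assms V_add by simp
next
  assume "a + b = v"
  then have "b = a + v" by (simp add: bit_fun_add_eq_iff)
  then show "pm (nb c a - nb c b) \<in> orbit c (zb c v)"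
    using assms by (auto simp: orbit_zb)
qed

lemma inj_on_orbit_zb: "inj_on (\<lambda>v. orbit c (zb c v)) (V c)"
proof (rule inj_onI)
  fix v w assume vw: "v \<in> V c" "w \<in> V c" "orbit c (zb c v) = orbit c (zb c w)"
  then have "pm (nb c 0 - nb c v) \<in> orbit c (zb c w)"
    using pm_nb_diff_in_orbit_iff[OF V_zero vw(1) vw(1)] by simp
  then show "v = w" using pm_nb_diff_in_orbit_iff[OF V_zero vw(1,2)] by simp
qed

section \<open>Directions of invariant sets of moves\<close>

text \<open>Only moves with the end \<open>nb c 0\<close> are inspected; an invariant
  \<open>M\<close> contains every move together with its translate to that end.\<close>

definition dirs :: "nat \<Rightarrow> tab set set \<Rightarrow> (nat \<Rightarrow> bit) set" where
  "dirs c M = {v \<in> V c. pm (zb c v) \<in> M}"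

text \<open>Inverse to \<open>dirs\<close>, between subsets of \<open>V c\<close> without 0 and
  invariant sets of moves.\<close>

definition dir_moves :: "nat \<Rightarrow> (nat \<Rightarrow> bit) set \<Rightarrow> tab set set" where
  "dir_moves c D = (\<Union>v\<in>D. orbit c (zb c v))"

lemma dirs_subset: "dirs c M \<subseteq> V c"
  by (auto simp: dirs_def)

lemma moves_nb:
  "moves c = {pm (nb c a - nb c b) | a b. a \<in> V c \<and> b \<in> V c \<and> a \<noteq> b}"
  unfolding moves_def F0_def using nb_eq_iff by (intro set_eqI) (fastforce)

lemma invariant_orbit_subset: "invariant c M \<Longrightarrow> pm z \<in> M \<Longrightarrow> orbit c z \<subseteq> M"
  by (auto simp: invariant_def orbit_def)

lemma pm_nb_diff_in_iff_dirs:
  assumes "invariant c M" "a \<in> V c" "b \<in> V c"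
  shows "pm (nb c a - nb c b) \<in> M \<longleftrightarrow> a + b \<in> dirs c M"
proof
  assume "pm (nb c a - nb c b) \<in> M"
  then have "orbit c (nb c a - nb c b) \<subseteq> M"
    using assms(1) invariant_orbit_subset by blast
  \<comment> \<open>This is the translate by \<open>a\<close>, whose first end is 0.\<close>
  moreover have "pm (nb c (a + a) - nb c (a + b)) \<in> orbit c (nb c a - nb c b)"
    unfolding orbit_nb_diff using assms(2) by blast
  ultimately show "a + b \<in> dirs c M"
    using assms V_add by (auto simp: dirs_def zb_def)
next
  assume "a + b \<in> dirs c M"
  then have "orbit c (zb c (a + b)) \<subseteq> M"
    using assms(1) invariant_orbit_subset by (auto simp: dirs_def)
  then show "pm (nb c a - nb c b) \<in> M"
    using pm_nb_diff_in_orbit_iff[OF assms(2,3) V_add] assms by blast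
qed

lemma dir_moves_dirs:
  assumes "M \<subseteq> moves c" "invariant c M"
  shows "dir_moves c (dirs c M) = M"
proof
  show "dir_moves c (dirs c M) \<subseteq> M"
    using assms(2) invariant_orbit_subset by (auto simp: dir_moves_def dirs_def)
  show "M \<subseteq> dir_moves c (dirs c M)"
  proof
    fix m assume m: "m \<in> M"
    then obtain a b where ab: "a \<in> V c" "b \<in> V c" "m = pm (nb c a - nb c b)"
      using assms(1) by (auto simp: moves_nb)
    then have "a + b \<in> dirs c M" using m pm_nb_diff_in_iff_dirs[OF assms(2)] by simp
    moreover have "m \<in> orbit c (zb c (a + b))"
      using ab pm_nb_diff_in_orbit_iff V_add by simp
    ultimately show "m \<in> dir_moves c (dirs c M)" by (auto simp: dir_moves_def)
  qed
qed

text \<open>The vector 0 has to be excluded, as it gives the zero difference.\<close>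

lemma dir_moves_subset_moves:
  assumes "D \<subseteq> V c" "0 \<notin> D"
  shows "dir_moves c D \<subseteq> moves c"
proof
  fix m assume "m \<in> dir_moves c D"
  then obtain v u where vu: "v \<in> D" "u \<in> V c" "m = pm (nb c u - nb c (u + v))"
    by (auto simp: dir_moves_def orbit_zb)
  then have "u \<noteq> u + v" "u + v \<in> V c" using assms V_add by auto
  then show "m \<in> moves c" using vu(2,3) unfolding moves_nb by blast
qed

lemma invariant_dir_moves:
  assumes "D \<subseteq> V c"
  shows "invariant c (dir_moves c D)"
  unfolding invariant_def
proof (intro ballI allI impI)
  fix g z assume g: "g \<in> S2_power c" and "pm z \<in> dir_moves c D"
  then obtain v u where vu: "v \<in> D" "u \<in> V c" "pm z = pm (nb c u - nb c (u + v))"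
    by (auto simp: dir_moves_def orbit_zb)
  \<comment> \<open>The representative \<open>z\<close> is arbitrary, so it agrees with the
    difference only up to sign.\<close>
  have "orbit c z = orbit c (nb c u - nb c (u + v))"
    using vu(3) orbit_uminus by (metis pm_eq_iff)
  also have "\<dots> = orbit c (zb c v)"
    using orbit_nb_diff_eq_orbit_zb[OF vu(2), of "u + v"] by simp
  finally have "pm (act c g z) \<in> orbit c (zb c v)" using g by (auto simp: orbit_def)
  then show "pm (act c g z) \<in> dir_moves c D" using vu(1) by (auto simp: dir_moves_def)
qed

lemma dirs_dir_moves:
  assumes "D \<subseteq> V c"
  shows "dirs c (dir_moves c D) = D"
proof -
  have "pm (zb c w) \<in> orbit c (zb c v) \<longleftrightarrow> w = v" if "v \<in> D" "w \<in> V c" for v w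
    using pm_nb_diff_in_orbit_iff[OF V_zero that(2), of v] that assms
    by (auto simp: zb_def)
  then show ?thesis using assms by (auto simp: dirs_def dir_moves_def)
qed

section \<open>Connectivity, spanning and minimality\<close>

text \<open>Over GF(2) a linear combination is just a sum of vectors, and such a sum, read term by
  term, is a walk in the fiber whose steps are directions.\<close>

lemma connects_iff_span:
  assumes inv: "invariant c M"
  shows "connects c M \<longleftrightarrow> gf2.span (dirs c M) = V c"
proof -
  let ?R = "{(m, m'). m \<in> F0 c \<and> m' \<in> F0 c \<and> pm (m' - m) \<in> M}"
  have edge: "(nb c a, nb c b) \<in> ?R \<longleftrightarrow> a + b \<in> dirs c M" if "a \<in> V c" "b \<in> V c" for a b
    using that pm_nb_diff_in_iff_dirs[OF inv that] pm_commute[of "nb c b"] by (auto simp: F0_def)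
  have reach: "v \<in> gf2.span (dirs c M)" if "(nb c 0, n) \<in> ?R\<^sup>*" "v \<in> V c" "n = nb c v" for n v
    using that
  proof (induction arbitrary: v rule: rtrancl_induct)
    case base
    then have "v = 0" using nb_eq_iff V_zero by metis
    then show ?case by (simp only: gf2.span_zero)
  next
    case (step m n)
    then obtain u where u: "u \<in> V c" "m = nb c u" by (auto simp: F0_def)
    then have "u + v \<in> dirs c M" using step edge by blast
    then have "u + (u + v) \<in> gf2.span (dirs c M)"
      by (rule gf2.span_add[OF step.IH[OF u] gf2.span_base])
    then show ?case by simp
  qed
  \<comment> \<open>Membership in \<open>V c\<close> is carried through the induction because
    \<open>edge\<close> asks for it at both ends.\<close>
  have path: "a + v \<in> V c \<and> (nb c a, nb c (a + v)) \<in> ?R\<^sup>*"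
    if "v \<in> gf2.span (dirs c M)" "a \<in> V c" for a v
    using that(1)
  proof (induction rule: gf2.span_induct_alt)
    case base
    then show ?case using that(2) by (simp only: add_0_right) blast
  next
    case (step k x y)
    show ?case
    \<comment> \<open>The scalar is 0 or 1: the walk stays as it is, or gains one edge in direction
      \<open>x\<close>.\<close>
    proof (cases k)
      case zero
      then show ?thesis using step by (simp only: gf2.scale_zero_left add_0_left)
    next
      case one
      then have k: "bscale k x + y = x + y" by (simp only: gf2.scale_one)
      have x: "x \<in> V c" using step dirs_subset by blast
      have ay: "a + y \<in> V c" using step by blast
      have axy: "a + (x + y) \<in> V c" using V_add[OF x ay] by (metis add.left_commute)
      have "(a + y) + (a + (x + y)) = x"
        by (metis add.assoc add.commute bit_fun_add_self_left)
      then have "(a + y) + (a + (x + y)) \<in> dirs c M" using step.hyps(1) by (simp only:)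
      then have "(nb c (a + y), nb c (a + (x + y))) \<in> ?R" by (rule edge[OF ay axy, THEN iffD2])
      then show ?thesis using step axy unfolding k by (meson rtrancl.rtrancl_into_rtrancl)
    qed
  qed
  show ?thesis
  proof
    assume "connects c M"
    then have "v \<in> gf2.span (dirs c M)" if "v \<in> V c" for v
      using that reach[of "nb c v" v] V_zero by (auto simp: connects_def F0_def)
    then show "gf2.span (dirs c M) = V c"
      using gf2.span_minimal[OF dirs_subset subspace_V] by blast
  next
    assume span: "gf2.span (dirs c M) = V c"
    have "(nb c a, nb c b) \<in> ?R\<^sup>*" if "a \<in> V c" "b \<in> V c" for a b
      using path[of "a + b" a] that V_add span by simp
    then show "connects c M" by (auto simp: connects_def F0_def)
  qed
qed

text \<open>\<open>dirs\<close> and \<open>dir_moves\<close> preserve inclusion and are mutually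
  inverse, so proper invariant subsets of \<open>M\<close> match proper subsets of
  \<open>dirs c M\<close>.\<close>

lemma minimal_connecting_iff_is_basis:
  assumes M: "M \<subseteq> moves c" "invariant c M"
  shows "minimal_connecting c M \<longleftrightarrow> is_basis c (dirs c M)"
proof -
  have "(\<forall>M'. M' \<subset> M \<and> invariant c M' \<longrightarrow> \<not> connects c M') \<longleftrightarrow>
        (\<forall>D. D \<subset> dirs c M \<longrightarrow> gf2.span D \<noteq> V c)" (is "?L \<longleftrightarrow> ?R")
  proof
    assume L: ?L
    show ?R
    proof (intro allI impI)
      fix D assume D: "D \<subset> dirs c M"
      then have DV: "D \<subseteq> V c" using dirs_subset by blast
      have "dir_moves c D \<subseteq> M"
        using D dir_moves_dirs[OF M] by (auto simp: dir_moves_def)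
      moreover have "dir_moves c D \<noteq> M" using D dirs_dir_moves[OF DV] by auto
      ultimately have "\<not> connects c (dir_moves c D)"
        using L invariant_dir_moves[OF DV] by blast
      then show "gf2.span D \<noteq> V c"
        using connects_iff_span[OF invariant_dir_moves[OF DV]] dirs_dir_moves[OF DV] by simp
    qed
  next
    assume R: ?R
    show ?L
    proof (intro allI impI)
      fix M' assume M': "M' \<subset> M \<and> invariant c M'"
      \<comment> \<open>Equal directions would let \<open>dir_moves\<close> recover the same set of
        moves from both.\<close>
      then have "dirs c M' \<noteq> dirs c M"
        using dir_moves_dirs[OF M] dir_moves_dirs[of M' c] M(1) by auto
      then have "dirs c M' \<subset> dirs c M" using M' by (auto simp: dirs_def)
      then show "\<not> connects c M'" using R connects_iff_span M' by blast
    qed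
  qed
  then show ?thesis
    using M connects_iff_span[OF M(2)] is_basis_iff_minimal_spanning[OF dirs_subset]
    by (simp add: minimal_connecting_def)
qed

lemma minimal_connecting_dir_moves:
  assumes "is_basis c B"
  shows "minimal_connecting c (dir_moves c B)"
proof -
  have B: "B \<subseteq> V c" "0 \<notin> B" using assms is_basis_nonzero by (auto simp: is_basis_def)
  then show ?thesis
    using minimal_connecting_iff_is_basis[OF dir_moves_subset_moves[OF B] invariant_dir_moves]
      dirs_dir_moves assms by simp
qed

section \<open>Orbits enumerated by directions\<close>

lemma orbits_eq_image_dirs:
  assumes M: "M \<subseteq> moves c" "invariant c M"
  shows "orbits c M = (\<lambda>v. orbit c (zb c v)) ` dirs c M"
proof
  show "(\<lambda>v. orbit c (zb c v)) ` dirs c M \<subseteq> orbits c M"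
    by (auto simp: orbits_def dirs_def)
  show "orbits c M \<subseteq> (\<lambda>v. orbit c (zb c v)) ` dirs c M"
  proof
    fix X assume "X \<in> orbits c M"
    then obtain z where z: "pm z \<in> M" "X = orbit c z" by (auto simp: orbits_def)
    then obtain a b where ab: "a \<in> V c" "b \<in> V c" "pm z = pm (nb c a - nb c b)"
      using M(1) by (auto simp: moves_nb)
    then have d: "a + b \<in> dirs c M" using z pm_nb_diff_in_iff_dirs[OF M(2)] by simp
    have "X = orbit c (nb c a - nb c b)"
      using z(2) ab(3) orbit_uminus by (metis pm_eq_iff)
    also have "\<dots> = orbit c (zb c (a + b))" by (rule orbit_nb_diff_eq_orbit_zb[OF ab(1)])
    finally show "X \<in> (\<lambda>v. orbit c (zb c v)) ` dirs c M" using d by blast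
  qed
qed

theorem theorem5:
  fixes c :: nat
  assumes "1 \<le> c"
  shows "(\<forall>M. M \<subseteq> moves c \<and> invariant c M \<longrightarrow>
            (minimal_connecting c M \<longleftrightarrow>
              (\<exists>v :: nat \<Rightarrow> nat \<Rightarrow> bit.
                 inj_on v {2..c} \<and> is_basis c (v ` {2..c}) \<and>
                 inj_on (\<lambda>k. orbit c (zb c (v k))) {2..c} \<and>
                 M = (\<Union>k\<in>{2..c}. orbit c (zb c (v k)))))) \<and>
         (\<exists>M. minimal_connecting c M) \<and>
         (\<forall>M. minimal_connecting c M \<longrightarrow> finite (orbits c M) \<and> card (orbits c M) = c - 1)"
proof (intro conjI allI impI)
  fix M assume "M \<subseteq> moves c \<and> invariant c M"
  then have M: "M \<subseteq> moves c" "invariant c M" by auto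
  show "minimal_connecting c M \<longleftrightarrow>
      (\<exists>v :: nat \<Rightarrow> nat \<Rightarrow> bit.
         inj_on v {2..c} \<and> is_basis c (v ` {2..c}) \<and>
         inj_on (\<lambda>k. orbit c (zb c (v k))) {2..c} \<and>
         M = (\<Union>k\<in>{2..c}. orbit c (zb c (v k))))" (is "_ \<longleftrightarrow> ?E")
  proof
    assume "minimal_connecting c M"
    then have B: "is_basis c (dirs c M)" using minimal_connecting_iff_is_basis[OF M] by simp
    then obtain v where "bij_betw v {2..c} (dirs c M)" using is_basis_bij_betw by blast
    then have v: "inj_on v {2..c}" "v ` {2..c} = dirs c M" by (auto simp: bij_betw_def)
    \<comment> \<open>Distinct directions have distinct orbits, so the orbits listed by
      \<open>v\<close> do not repeat.\<close>
    have "inj_on (\<lambda>w. orbit c (zb c w)) (v ` {2..c})"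
      using inj_on_subset[OF inj_on_orbit_zb dirs_subset] v(2) by metis
    then have "inj_on (\<lambda>k. orbit c (zb c (v k))) {2..c}"
      using comp_inj_on[OF v(1)] by (simp add: comp_def)
    moreover have "M = (\<Union>k\<in>{2..c}. orbit c (zb c (v k)))"
      using dir_moves_dirs[OF M] unfolding dir_moves_def v(2)[symmetric] by simp
    ultimately show ?E using v B by (intro exI[of _ v]) simp
  next
    assume ?E
    then obtain v where "is_basis c (v ` {2..c})" "M = dir_moves c (v ` {2..c})"
      by (auto simp: dir_moves_def)
    then show "minimal_connecting c M" using minimal_connecting_dir_moves by simp
  qed
next
  \<comment> \<open>Existence keeps the orbit count from holding vacuously.\<close>
  show "\<exists>M. minimal_connecting c M"
    using minimal_connecting_dir_moves is_basis_unit_vec by blast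
next
  fix M assume mc: "minimal_connecting c M"
  then have M: "M \<subseteq> moves c" "invariant c M" by (auto simp: minimal_connecting_def)
  then obtain v where "bij_betw v {2..c} (dirs c M)"
    using mc minimal_connecting_iff_is_basis is_basis_bij_betw by blast
  moreover have "bij_betw (\<lambda>v. orbit c (zb c v)) (dirs c M) (orbits c M)"
    using inj_on_subset[OF inj_on_orbit_zb dirs_subset]
    by (simp add: orbits_eq_image_dirs[OF M] bij_betw_def)
  \<comment> \<open>Indices match basis vectors and these match orbits, so the count is the size
    \<open>c - 1\<close> of \<open>{2..c}\<close>.\<close>
  ultimately have "\<exists>f. bij_betw f {2..c} (orbits c M)" using bij_betw_trans by blast
  then show "finite (orbits c M)" "card (orbits c M) = c - 1"
    using bij_betw_finite bij_betw_same_card by fastforce+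
qed

end
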